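(* Let $G$ be a connected, simply connected complex semisimple linear algebraic group with Borel subgroup $B$, maximal torus $T\subset B$ and Weyl group $W$. Let $\eta\colon\mathbb{C}^\times\to T$ be a cocharacter, $G'=Z_G(\eta(\mathbb{C}^\times))$, $B'=G'\cap B$, with Weyl group $W'\subset W$, and let $\mathcal{F}=G/B$ and $\mathcal{F}'=G'/B'$. Let $\varsigma\in W$ have minimal length in its coset $W'\varsigma$, let $\iota_\varsigma\colon\mathcal{F}'\hookrightarrow\mathcal{F}$ be the corresponding section of the pattern map, and write also $\iota_\varsigma\colon(\mathcal{F}')^T\to\mathcal{F}^T$ for its restriction to $T$-fixed points. Let $\phi\in H^*_T(\mathcal{F}^T)=\mathrm{Maps}(W,S)$. Then $\iota_\varsigma^*(\phi)\in H^*_T((\mathcal{F}')^T)=\mathrm{Maps}(W',S)$ is the map whose value at $w\in W'$ is $\phi(w\varsigma)$.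
   Context: Groups. $W=N_G(T)/T$ is the Weyl group of $G$, with length function determined by $B$. With $T_\eta=\eta(\mathbb{C}^\times)$, the centralizer $G'=Z_G(T_\eta)$ is a connected reductive group with maximal torus $T$, $B'=G'\cap B$ is a Borel subgroup of $G'$, and $W'=N_{G'}(T)/T\subset W$ is its Weyl group. Cosets are right cosets $W'\varsigma\in W'\backslash W$. Pattern map. Points of $\mathcal{F}=G/B$ are identified with Borel subgroups of $G$, $gB\leftrightarrow gBg^{-1}$; write $w.B$ for the $T$-fixed point of $\mathcal{F}$ corresponding to $w\in W$ (and $w.B'\in\mathcal{F}'$ for $w\in W'$). Let $\mathcal{F}^\eta$ be the set of $T_\eta$-fixed points of $\mathcal{F}$. The pattern map $\psi\colon\mathcal{F}^\eta\to\mathcal{F}'$ sends $B_0$ to $B_0\cap G'$; it is $G'$-equivariant and restricts to an isomorphism from each connected component of $\mathcal{F}^\eta$ onto $\mathcal{F}'$, and the components are in bijection with $W'\backslash W$. For $\varsigma$ of minimal length in $W'\varsigma$, the section $\iota_\varsigma\colon\mathcal{F}'\to\mathcal{F}$ is the inverse of $\psi$ on the component corresponding to $W'\varsigma$; it is the unique $G'$-equivariant map with $\iota_\varsigma(e.B')=\varsigma.B$. Localization. $H^*_T(Y)=H^*(ET\times_TY,\mathbb{Q})$ and $S=H^*_T(\mathrm{pt})$, the symmetric algebra over $\mathbb{Q}$ of the character group of $T$. The $T$-fixed points $\mathcal{F}^T=\{w.B\mid w\in W\}$ are identified with $W$, so $H^*_T(\mathcal{F}^T)=\bigoplus_{w\in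 W}S=\mathrm{Maps}(W,S)$, where the value of a class at $w$ is its restriction to the point $w.B$. Likewise $(\mathcal{F}')^T=\{w.B'\mid w\in W'\}$ and $H^*_T((\mathcal{F}')^T)=\mathrm{Maps}(W',S)$. *)

theory Defs
  imports
    "HOL-Analysis.Analysis"
    "HOL-Algebra.Left_Coset"
    "HOL-Algebra.Group_Action"
    "HOL-Algebra.Solvable_Groups"
    "HOL-Algebra.QuotRing"
    "HOL-Library.Poly_Mapping"
begin

section \<open>Linear algebraic groups over the complex numbers\<close>

text \<open>
  A linear algebraic group is a Zariski closed subgroup of some \<open>GL\<^sub>n(\<complex>)\<close>; the size \<open>n\<close> is the
  cardinality of the index type.  Subgroups are plain sets of matrices, and products, cosets and
  quotients are formed in the monoid \<open>GLC\<close> (with its carrier replaced where necessary).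
\<close>

definition GLC :: "(complex^'n^'n) monoid" where
  "GLC = \<lparr>carrier = {A. invertible A}, monoid.mult = (**), one = mat 1\<rparr>"

abbreviation grp :: "(complex^'n^'n) set \<Rightarrow> (complex^'n^'n) monoid" where
  "grp H \<equiv> GLC\<lparr>carrier := H\<rparr>"

inductive_set fun_algebra :: "('x \<Rightarrow> complex) set \<Rightarrow> ('x \<Rightarrow> complex) set"
  for F :: "('x \<Rightarrow> complex) set" where
  gen: "f \<in> F \<Longrightarrow> f \<in> fun_algebra F"
| const: "(\<lambda>_. c) \<in> fun_algebra F"
| add: "f \<in> fun_algebra F \<Longrightarrow> g \<in> fun_algebra F \<Longrightarrow> (\<lambda>x. f x + g x) \<in> fun_algebra F"
| mult: "f \<in> fun_algebra F \<Longrightarrow> g \<in> fun_algebra F \<Longrightarrow> (\<lambda>x. f x * g x) \<in> fun_algebra F"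

definition regular_funs :: "(complex^'n^'n \<Rightarrow> complex) set" where
  "regular_funs = fun_algebra ({(\<lambda>A. A $ i $ j) |i j. True} \<union> {\<lambda>A. inverse (det A)})"

definition zariski :: "(complex^'n^'n) topology" where
  "zariski = topology (\<lambda>U. \<exists>F \<subseteq> regular_funs. U = {A. invertible A \<and> (\<exists>f\<in>F. f A \<noteq> 0)})"

lemma istopology_zariski:
  "istopology (\<lambda>U. \<exists>F \<subseteq> regular_funs. U = {A::complex^'n^'n. invertible A \<and> (\<exists>f\<in>F. f A \<noteq> 0)})"
  unfolding istopology_def
proof (intro conjI allI impI)
  fix S T :: "(complex^'n^'n) set"
  assume "\<exists>F \<subseteq> regular_funs. S = {A. invertible A \<and> (\<exists>f\<in>F. f A \<noteq> 0)}"
    and "\<exists>F \<subseteq> regular_funs. T = {A. invertible A \<and> (\<exists>f\<in>F. f A \<noteq> 0)}"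
  then obtain E F where E: "E \<subseteq> regular_funs" "S = {A. invertible A \<and> (\<exists>f\<in>E. f A \<noteq> 0)}"
    and F: "F \<subseteq> regular_funs" "T = {A. invertible A \<and> (\<exists>f\<in>F. f A \<noteq> 0)}" by blast
  define H where "H = {(\<lambda>A. f A * g A) |f g. f \<in> E \<and> g \<in> F}"
  have "H \<subseteq> regular_funs"
    using E(1) F(1) unfolding H_def regular_funs_def by (auto intro!: fun_algebra.mult)
  moreover have "S \<inter> T = {A. invertible A \<and> (\<exists>f\<in>H. f A \<noteq> 0)}"
  proof (rule Set.set_eqI)
    fix A
    have "(\<exists>h\<in>H. h A \<noteq> 0) \<longleftrightarrow> (\<exists>f\<in>E. \<exists>g\<in>F. f A * g A \<noteq> 0)"
      unfolding H_def by fast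
    then show "A \<in> S \<inter> T \<longleftrightarrow> A \<in> {A. invertible A \<and> (\<exists>h\<in>H. h A \<noteq> 0)}"
      unfolding E(2) F(2) by auto
  qed
  ultimately show "\<exists>F \<subseteq> regular_funs. S \<inter> T = {A. invertible A \<and> (\<exists>f\<in>F. f A \<noteq> 0)}" by blast
next
  fix K :: "(complex^'n^'n) set set"
  assume *: "\<forall>U\<in>K. \<exists>F \<subseteq> regular_funs. U = {A. invertible A \<and> (\<exists>f\<in>F. f A \<noteq> 0)}"
  define H where "H = \<Union>{F. F \<subseteq> regular_funs \<and> {A. invertible A \<and> (\<exists>f\<in>F. f A \<noteq> 0)} \<in> K}"
  have "H \<subseteq> regular_funs" unfolding H_def by auto
  moreover have "\<Union>K = {A. invertible A \<and> (\<exists>f\<in>H. f A \<noteq> 0)}" (is "_ = ?R")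
  proof
    show "\<Union>K \<subseteq> ?R"
    proof
      fix A assume "A \<in> \<Union>K"
      then obtain U where U: "U \<in> K" "A \<in> U" by blast
      with * obtain F where F: "F \<subseteq> regular_funs" "U = {A. invertible A \<and> (\<exists>f\<in>F. f A \<noteq> 0)}" by blast
      then have "F \<subseteq> H" using U(1) unfolding H_def by (intro Union_upper) simp
      then show "A \<in> ?R" using U(2) F(2) by auto
    qed
    show "?R \<subseteq> \<Union>K"
    proof
      fix A assume A: "A \<in> ?R"
      then obtain f where "f \<in> H" "f A \<noteq> 0" by auto
      then obtain F where "f \<in> F" "{A. invertible A \<and> (\<exists>f\<in>F. f A \<noteq> 0)} \<in> K"
        unfolding H_def by auto
      with A \<open>f A \<noteq> 0\<close> show "A \<in> \<Union>K" by (intro UnionI) auto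
    qed
  qed
  ultimately show "\<exists>F \<subseteq> regular_funs. \<Union>K = {A. invertible A \<and> (\<exists>f\<in>F. f A \<noteq> 0)}" by blast
qed

lemma openin_zariski:
  "openin zariski U \<longleftrightarrow> (\<exists>F \<subseteq> regular_funs. U = {A. invertible A \<and> (\<exists>f\<in>F. f A \<noteq> 0)})"
  unfolding zariski_def by (simp add: istopology_zariski)

definition algebraic_group :: "(complex^'n^'n) set \<Rightarrow> bool" where
  "algebraic_group H \<longleftrightarrow> subgroup H GLC \<and> closedin zariski H"

abbreviation connected_group :: "(complex^'n^'n) set \<Rightarrow> bool" where
  "connected_group H \<equiv> connectedin zariski H"

definition semisimple_group :: "(complex^'n^'n) set \<Rightarrow> bool" where
  "semisimple_group G \<longleftrightarrow>
     (\<forall>R. algebraic_group R \<and> connected_group R \<and> R \<lhd> grp G \<and> solvable (grp R) \<longrightarrow> R = {mat 1})"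

definition borel_subgroup :: "(complex^'n^'n) set \<Rightarrow> (complex^'n^'n) set \<Rightarrow> bool" where
  "borel_subgroup G B \<longleftrightarrow>
     B \<subseteq> G \<and> algebraic_group B \<and> connected_group B \<and> solvable (grp B) \<and>
     (\<forall>B'. B \<subseteq> B' \<and> B' \<subseteq> G \<and> algebraic_group B' \<and> connected_group B' \<and> solvable (grp B') \<longrightarrow> B' = B)"

text \<open>
  Characters are extensional, i.e. equal to \<open>undefined\<close> outside \<open>T\<close>, so that equality of characters
  is equality of functions.
\<close>

definition characters :: "(complex^'n^'n) set \<Rightarrow> (complex^'n^'n \<Rightarrow> complex) set" where
  "characters T = {\<xi> \<in> extensional T.
     (\<exists>f \<in> regular_funs. \<forall>t\<in>T. \<xi> t = f t) \<and>
     (\<forall>t\<in>T. \<xi> t \<noteq> 0) \<and> (\<forall>s\<in>T. \<forall>t\<in>T. \<xi> (s ** t) = \<xi> s * \<xi> t)}"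

text \<open>
  A torus is an algebraic group isomorphic to some \<open>(\<complex>\<^sup>\<times>)\<^sup>k\<close>: the components of the isomorphism are
  characters, and the matrix entries are Laurent polynomials in them.
\<close>

definition torus :: "(complex^'n^'n) set \<Rightarrow> bool" where
  "torus T \<longleftrightarrow> algebraic_group T \<and>
     (\<exists>k::nat. \<exists>\<xi> :: nat \<Rightarrow> complex^'n^'n \<Rightarrow> complex.
        (\<forall>l<k. \<xi> l \<in> characters T) \<and>
        bij_betw (\<lambda>t. \<lambda>l\<in>{..<k}. \<xi> l t) T ({..<k} \<rightarrow>\<^sub>E - {0}) \<and>
        (\<forall>i j. \<exists>p \<in> fun_algebra ({(\<lambda>z. z l) |l. l < k} \<union> {(\<lambda>z. inverse (z l)) |l. l < k}).
           \<forall>t\<in>T. t $ i $ j = p (\<lambda>l\<in>{..<k}. \<xi> l t)))"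

definition maximal_torus :: "(complex^'n^'n) set \<Rightarrow> (complex^'n^'n) set \<Rightarrow> bool" where
  "maximal_torus G T \<longleftrightarrow> T \<subseteq> G \<and> torus T \<and> (\<forall>T'. T \<subseteq> T' \<and> T' \<subseteq> G \<and> torus T' \<longrightarrow> T' = T)"

text \<open>Cocharacters are constrained on \<open>\<complex>\<^sup>\<times>\<close> only; the value at \<open>0\<close> is irrelevant.\<close>

definition cocharacter :: "(complex^'n^'n) set \<Rightarrow> (complex \<Rightarrow> complex^'n^'n) \<Rightarrow> bool" where
  "cocharacter T \<eta> \<longleftrightarrow>
     (\<forall>z. z \<noteq> 0 \<longrightarrow> \<eta> z \<in> T) \<and>
     (\<forall>z w. z \<noteq> 0 \<longrightarrow> w \<noteq> 0 \<longrightarrow> \<eta> (z * w) = \<eta> z ** \<eta> w) \<and>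
     (\<forall>i j. \<exists>p \<in> fun_algebra {\<lambda>z. z, inverse}. \<forall>z. z \<noteq> 0 \<longrightarrow> \<eta> z $ i $ j = p z)"

definition cochar_image :: "(complex \<Rightarrow> complex^'n^'n) \<Rightarrow> (complex^'n^'n) set" where
  "cochar_image \<eta> = \<eta> ` (- {0})"

definition centralizer :: "(complex^'n^'n) set \<Rightarrow> (complex^'n^'n) set \<Rightarrow> (complex^'n^'n) set" where
  "centralizer G X = {g \<in> G. \<forall>x\<in>X. g ** x = x ** g}"


section \<open>The Weyl group and its length function\<close>

text \<open>
  Elements of \<open>N\<^sub>G(T)/T\<close> are cosets, hence sets of matrices.  For \<open>T \<subseteq> G' \<subseteq> G\<close> the inclusion of
  \<open>N\<^bsub>G'\<^esub>(T)/T\<close> in \<open>N\<^sub>G(T)/T\<close> is therefore an inclusion of carriers.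
\<close>

definition weyl_group :: "(complex^'n^'n) set \<Rightarrow> (complex^'n^'n) set \<Rightarrow> (complex^'n^'n) set monoid" where
  "weyl_group G T = grp (normalizer (grp G) T) Mod T"

text \<open>
  The tangent space at the identity: the matrices \<open>X\<close> along which every regular function vanishing
  on \<open>H\<close> has derivative \<open>0\<close> at the identity.
\<close>

definition lie_algebra :: "(complex^'n^'n) set \<Rightarrow> (complex^'n^'n) set" where
  "lie_algebra H = {X. \<forall>f \<in> regular_funs. (\<forall>h\<in>H. f h = 0) \<longrightarrow>
     deriv (\<lambda>z::complex. f (\<chi> i j. mat 1 $ i $ j + z * X $ i $ j)) 0 = 0}"

definition roots :: "(complex^'n^'n) set \<Rightarrow> (complex^'n^'n) set \<Rightarrow> (complex^'n^'n \<Rightarrow> complex) set" where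
  "roots H T = {\<alpha> \<in> characters T. (\<exists>t\<in>T. \<alpha> t \<noteq> 1) \<and>
     (\<exists>X \<in> lie_algebra H. X \<noteq> 0 \<and>
        (\<forall>t\<in>T. \<forall>i j. (t ** X ** matrix_inv t) $ i $ j = \<alpha> t * X $ i $ j))}"

text \<open>The positive roots are those of \<open>B\<close>; the character group is written multiplicatively.\<close>

definition simple_roots :: "(complex^'n^'n) set \<Rightarrow> (complex^'n^'n) set \<Rightarrow> (complex^'n^'n \<Rightarrow> complex) set" where
  "simple_roots B T = {\<alpha> \<in> roots B T.
     \<not> (\<exists>\<beta> \<in> roots B T. \<exists>\<gamma> \<in> roots B T. \<alpha> = (\<lambda>t\<in>T. \<beta> t * \<gamma> t))}"

text \<open>
  The reflection \<open>s\<^sub>\<alpha>\<close> is the nontrivial element of the (two-element) Weyl group of the centralizer of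
  the identity component of \<open>ker \<alpha>\<close>.
\<close>

definition simple_reflections ::
  "(complex^'n^'n) set \<Rightarrow> (complex^'n^'n) set \<Rightarrow> (complex^'n^'n) set \<Rightarrow> (complex^'n^'n) set set" where
  "simple_reflections G B T = {s. \<exists>\<alpha> \<in> simple_roots B T.
     s \<in> carrier (weyl_group
            (centralizer G (connected_component_of_set (subtopology zariski {t \<in> T. \<alpha> t = 1}) (mat 1))) T) \<and>
     s \<noteq> \<one>\<^bsub>weyl_group G T\<^esub>}"

definition weyl_length ::
  "(complex^'n^'n) set \<Rightarrow> (complex^'n^'n) set \<Rightarrow> (complex^'n^'n) set \<Rightarrow> (complex^'n^'n) set \<Rightarrow> nat" where
  "weyl_length G B T w = (LEAST k. \<exists>ss. length ss = k \<and> set ss \<subseteq> simple_reflections G B T \<and>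
     foldr (\<lambda>s v. s \<otimes>\<^bsub>weyl_group G T\<^esub> v) ss \<one>\<^bsub>weyl_group G T\<^esub> = w)"

definition min_length_in_coset ::
  "(complex^'n^'n) set \<Rightarrow> (complex^'n^'n) set \<Rightarrow> (complex^'n^'n) set \<Rightarrow> (complex^'n^'n) set \<Rightarrow>
   (complex^'n^'n) set \<Rightarrow> bool" where
  "min_length_in_coset G B T G' \<sigma> \<longleftrightarrow>
     (\<forall>v \<in> carrier (weyl_group G' T) #>\<^bsub>weyl_group G T\<^esub> \<sigma>. weyl_length G B T \<sigma> \<le> weyl_length G B T v)"


section \<open>Flag varieties and the pattern map\<close>

text \<open>Points of \<open>G/B\<close> are left cosets, on which \<open>g \<in> G\<close> acts by \<open>x \<mapsto> g <# x\<close>.\<close>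

definition flag_variety :: "(complex^'n^'n) set \<Rightarrow> (complex^'n^'n) set \<Rightarrow> (complex^'n^'n) set set" where
  "flag_variety G B = lcosets\<^bsub>grp G\<^esub> B"

definition flag_topology :: "(complex^'n^'n) set \<Rightarrow> (complex^'n^'n) set \<Rightarrow> (complex^'n^'n) set topology" where
  "flag_topology G B = topology (\<lambda>U. U \<subseteq> flag_variety G B \<and>
     openin (subtopology zariski G) {g \<in> G. g <#\<^bsub>GLC\<^esub> B \<in> U})"

lemma openin_flag_topology:
  "openin (flag_topology G B) U \<longleftrightarrow> U \<subseteq> flag_variety G B \<and>
     openin (subtopology zariski G) {g \<in> G. g <#\<^bsub>GLC\<^esub> B \<in> U}"
proof -
  have "istopology (\<lambda>U. U \<subseteq> flag_variety G B \<and>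
          openin (subtopology zariski G) {g \<in> G. g <#\<^bsub>GLC\<^esub> B \<in> U})"
    unfolding istopology_def
  proof (intro conjI allI impI)
    fix S T
    assume "S \<subseteq> flag_variety G B \<and> openin (subtopology zariski G) {g \<in> G. g <#\<^bsub>GLC\<^esub> B \<in> S}"
      and "T \<subseteq> flag_variety G B \<and> openin (subtopology zariski G) {g \<in> G. g <#\<^bsub>GLC\<^esub> B \<in> T}"
    moreover have "{g \<in> G. g <#\<^bsub>GLC\<^esub> B \<in> S \<inter> T} =
        {g \<in> G. g <#\<^bsub>GLC\<^esub> B \<in> S} \<inter> {g \<in> G. g <#\<^bsub>GLC\<^esub> B \<in> T}" by blast
    ultimately show "S \<inter> T \<subseteq> flag_variety G B"
      and "openin (subtopology zariski G) {g \<in> G. g <#\<^bsub>GLC\<^esub> B \<in> S \<inter> T}" by auto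
  next
    fix K
    assume *: "\<forall>U\<in>K. U \<subseteq> flag_variety G B \<and>
        openin (subtopology zariski G) {g \<in> G. g <#\<^bsub>GLC\<^esub> B \<in> U}"
    then show "\<Union>K \<subseteq> flag_variety G B" by blast
    have "{g \<in> G. g <#\<^bsub>GLC\<^esub> B \<in> \<Union>K} = \<Union>((\<lambda>U. {g \<in> G. g <#\<^bsub>GLC\<^esub> B \<in> U}) ` K)" by blast
    moreover have "openin (subtopology zariski G) (\<Union>((\<lambda>U. {g \<in> G. g <#\<^bsub>GLC\<^esub> B \<in> U}) ` K))"
      by (rule openin_Union) (use * in blast)
    ultimately show "openin (subtopology zariski G) {g \<in> G. g <#\<^bsub>GLC\<^esub> B \<in> \<Union>K}" by (simp only:)
  qed
  then show ?thesis unfolding flag_topology_def by simp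
qed

definition fixed_points :: "(complex^'n^'n) set set \<Rightarrow> (complex^'n^'n) set \<Rightarrow> (complex^'n^'n) set set" where
  "fixed_points X H = {x \<in> X. \<forall>h\<in>H. h <#\<^bsub>GLC\<^esub> x = x}"

text \<open>
  The point \<open>w.B\<close> for \<open>w = nT\<close> in the Weyl group: the set product \<open>(nT)B\<close> is the coset \<open>nB\<close>, as
  \<open>T \<subseteq> B\<close>.
\<close>

definition weyl_point :: "(complex^'n^'n) set \<Rightarrow> (complex^'n^'n) set \<Rightarrow> (complex^'n^'n) set" where
  "weyl_point B w = w <#>\<^bsub>GLC\<^esub> B"

text \<open>The Borel subgroup \<open>gBg\<^sup>-\<^sup>1 = (gB)(gB)\<^sup>-\<^sup>1\<close> identified with the point \<open>x = gB\<close>.\<close>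

definition borel_at :: "(complex^'n^'n) set \<Rightarrow> (complex^'n^'n) set" where
  "borel_at x = x <#>\<^bsub>GLC\<^esub> (set_inv\<^bsub>GLC\<^esub> x)"

text \<open>\<open>B\<^sub>0 \<mapsto> B\<^sub>0 \<inter> G'\<close>, read through the identification of points with Borel subgroups.\<close>

definition pattern_map ::
  "(complex^'n^'n) set \<Rightarrow> (complex^'n^'n) set \<Rightarrow> (complex^'n^'n) set \<Rightarrow> (complex^'n^'n) set" where
  "pattern_map G' B' x = (THE y. y \<in> flag_variety G' B' \<and> borel_at y = borel_at x \<inter> G')"

definition fixed_component ::
  "(complex^'n^'n) set \<Rightarrow> (complex^'n^'n) set \<Rightarrow> (complex \<Rightarrow> complex^'n^'n) \<Rightarrow>
   (complex^'n^'n) set \<Rightarrow> (complex^'n^'n) set set" where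
  "fixed_component G B \<eta> \<sigma> = connected_component_of_set
     (subtopology (flag_topology G B) (fixed_points (flag_variety G B) (cochar_image \<eta>)))
     (weyl_point B \<sigma>)"

text \<open>
  \<open>\<iota>\<close> is the section of the pattern map attached to \<open>\<sigma>\<close>: it inverts the pattern map on the component
  of \<open>\<F>\<^sup>\<eta>\<close> through \<open>\<sigma>.B\<close>, and it is the \<open>G'\<close>-equivariant map sending the base point \<open>e.B'\<close> to
  \<open>\<sigma>.B\<close>.  Only its values on \<open>G'/B'\<close> matter, and each of the two descriptions determines them.
\<close>

definition pattern_section ::
  "(complex^'n^'n) set \<Rightarrow> (complex^'n^'n) set \<Rightarrow> (complex^'n^'n) set \<Rightarrow> (complex \<Rightarrow> complex^'n^'n) \<Rightarrow>
   (complex^'n^'n) set \<Rightarrow> (complex^'n^'n) set \<Rightarrow> (complex^'n^'n) set \<Rightarrow>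
   ((complex^'n^'n) set \<Rightarrow> (complex^'n^'n) set) \<Rightarrow> bool" where
  "pattern_section G B T \<eta> G' B' \<sigma> \<iota> \<longleftrightarrow>
     bij_betw (pattern_map G' B') (fixed_component G B \<eta> \<sigma>) (flag_variety G' B') \<and>
     (\<forall>y \<in> flag_variety G' B'. \<iota> y = the_inv_into (fixed_component G B \<eta> \<sigma>) (pattern_map G' B') y) \<and>
     (\<forall>g \<in> G'. \<forall>y \<in> flag_variety G' B'. \<iota> (g <#\<^bsub>GLC\<^esub> y) = g <#\<^bsub>GLC\<^esub> \<iota> y) \<and>
     \<iota> (weyl_point B' \<one>\<^bsub>weyl_group G' T\<^esub>) = weyl_point B \<sigma>"


section \<open>Equivariant cohomology of finite sets of fixed points\<close>

text \<open>
  The symmetric algebra over \<open>\<rat>\<close> of the character group: the polynomial ring over \<open>\<rat>\<close> in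
  variables indexed by the characters of \<open>T\<close>, modulo the relations making \<open>\<xi> \<mapsto> x\<^sub>\<xi>\<close> additive.
\<close>

definition character_polys ::
  "(complex^'n^'n) set \<Rightarrow> (((complex^'n^'n \<Rightarrow> complex) \<Rightarrow>\<^sub>0 nat) \<Rightarrow>\<^sub>0 rat) ring" where
  "character_polys T =
     \<lparr>carrier = {p. \<forall>m \<in> Poly_Mapping.keys p. Poly_Mapping.keys m \<subseteq> characters T},
      monoid.mult = (*), one = 1, zero = 0, ring.add = (+)\<rparr>"

definition char_var ::
  "(complex^'n^'n \<Rightarrow> complex) \<Rightarrow> (((complex^'n^'n \<Rightarrow> complex) \<Rightarrow>\<^sub>0 nat) \<Rightarrow>\<^sub>0 rat)" where
  "char_var \<xi> = Poly_Mapping.single (Poly_Mapping.single \<xi> 1) 1"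

definition sym_algebra ::
  "(complex^'n^'n) set \<Rightarrow> (((complex^'n^'n \<Rightarrow> complex) \<Rightarrow>\<^sub>0 nat) \<Rightarrow>\<^sub>0 rat) set ring" where
  "sym_algebra T = character_polys T Quot
     (Idl\<^bsub>character_polys T\<^esub>
        {char_var (\<lambda>t\<in>T. \<xi> t * \<xi>' t) - char_var \<xi> - char_var \<xi>' |\<xi> \<xi>'.
           \<xi> \<in> characters T \<and> \<xi>' \<in> characters T})"

text \<open>
  For a finite set \<open>X\<close> with trivial \<open>T\<close>-action, \<open>H\<^sup>*\<^sub>T(X) = \<Oplus>\<^bsub>x\<in>X\<^esub> S = Maps(X,S)\<close>; the value of a class at
  \<open>x\<close> is its restriction to \<open>x\<close>, and pullback along a map of such sets is precomposition.
\<close>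

definition equiv_cohomology ::
  "(complex^'n^'n) set \<Rightarrow> 'p set \<Rightarrow>
   ('p \<Rightarrow> (((complex^'n^'n \<Rightarrow> complex) \<Rightarrow>\<^sub>0 nat) \<Rightarrow>\<^sub>0 rat) set) set" where
  "equiv_cohomology T X = X \<rightarrow>\<^sub>E carrier (sym_algebra T)"

definition pullback :: "'p set \<Rightarrow> ('p \<Rightarrow> 'q) \<Rightarrow> ('q \<Rightarrow> 's) \<Rightarrow> 'p \<Rightarrow> 's" where
  "pullback X f c = (\<lambda>x\<in>X. c (f x))"

text \<open>
  The identification \<open>H\<^sup>*\<^sub>T((G/B)\<^sup>T) = Maps(W,S)\<close>: the value of a class at \<open>w\<close> is its restriction to
  \<open>w.B\<close>.
\<close>

definition weyl_values ::
  "(complex^'n^'n) set \<Rightarrow> (complex^'n^'n) set \<Rightarrow> (complex^'n^'n) set \<Rightarrow>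
   ((complex^'n^'n) set \<Rightarrow> 's) \<Rightarrow> (complex^'n^'n) set \<Rightarrow> 's" where
  "weyl_values G B T c = (\<lambda>w \<in> carrier (weyl_group G T). c (weyl_point B w))"

end

theory Submission
  imports Defs "HOL-Algebra.Zassenhaus"
begin

text \<open>
  For \<open>w = nT\<close> in \<open>W'\<close> equivariance gives
  \<open>\<iota>(w.B') = \<iota>(n \<cdot> e.B') = n \<cdot> \<sigma>.B = (w\<sigma>).B\<close>.  Since \<open>T\<close> is commutative it is contained in \<open>G'\<close>,
  so \<open>\<iota>\<close> is \<open>T\<close>-equivariant and preserves \<open>T\<close>-fixed points.
\<close>

section \<open>Subgroups of the general linear group, centralizers and tori\<close>

lemma GLC_simps [simp]:
  "carrier GLC = {A. invertible A}" "A \<otimes>\<^bsub>GLC\<^esub> B = A ** B" "\<one>\<^bsub>GLC\<^esub> = mat 1"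
  by (simp_all add: GLC_def)

lemma group_GLC: "group (GLC :: (complex^'n^'n) monoid)"
proof (rule groupI)
  fix A :: "complex^'n^'n"
  assume "A \<in> carrier GLC"
  then obtain A' where "A ** A' = mat 1" "A' ** A = mat 1"
    by (auto simp: invertible_def)
  then show "\<exists>A'\<in>carrier GLC. A' \<otimes>\<^bsub>GLC\<^esub> A = \<one>\<^bsub>GLC\<^esub>"
    by (auto simp: invertible_def)
qed (auto simp: matrix_mul_assoc invertible_mult, auto simp: invertible_def)

interpretation GLC: group "GLC :: (complex^'n^'n) monoid"
  by (rule group_GLC)

lemma (in group) subgroup_centralizing:
  assumes "subgroup H G" "X \<subseteq> carrier G"
  shows "subgroup {g \<in> H. \<forall>x\<in>X. g \<otimes> x = x \<otimes> g} G"
proof (rule subgroupI)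
  note [simp] = subgroup.mem_carrier[OF assms(1)] subsetD[OF assms(2)]
  show "{g \<in> H. \<forall>x\<in>X. g \<otimes> x = x \<otimes> g} \<noteq> {}"
    using subgroup.one_closed[OF assms(1)] by auto
  show "inv a \<in> {g \<in> H. \<forall>x\<in>X. g \<otimes> x = x \<otimes> g}" if a: "a \<in> {g \<in> H. \<forall>x\<in>X. g \<otimes> x = x \<otimes> g}" for a
  proof -
    have aH: "a \<in> H" using a by blast
    have "inv a \<otimes> x = x \<otimes> inv a" if x: "x \<in> X" for x
    proof -
      \<comment> \<open>Appending \<open>a \<otimes> inv a\<close> exposes
        \<open>x \<otimes> a\<close>, the product to which commutation with \<open>a\<close>
        applies.\<close>
      have "inv a \<otimes> x = inv a \<otimes> (x \<otimes> a) \<otimes> inv a"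
        using aH x by (simp add: m_assoc)
      also have "x \<otimes> a = a \<otimes> x"
        using a x by simp
      also have "inv a \<otimes> (a \<otimes> x) \<otimes> inv a = x \<otimes> inv a"
        using aH x by (simp add: m_assoc[symmetric])
      finally show ?thesis .
    qed
    then show ?thesis
      using aH subgroup.m_inv_closed[OF assms(1)] by auto
  qed
  show "a \<otimes> b \<in> {g \<in> H. \<forall>x\<in>X. g \<otimes> x = x \<otimes> g}"
    if "a \<in> {g \<in> H. \<forall>x\<in>X. g \<otimes> x = x \<otimes> g}" "b \<in> {g \<in> H. \<forall>x\<in>X. g \<otimes> x = x \<otimes> g}" for a b
  proof -
    have "a \<otimes> b \<otimes> x = x \<otimes> (a \<otimes> b)" if "x \<in> X" for x
    proof -
      have "a \<otimes> b \<otimes> x = a \<otimes> (x \<otimes> b)"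
        using \<open>a \<in> _\<close> \<open>b \<in> _\<close> that by (simp add: m_assoc)
      also have "\<dots> = x \<otimes> (a \<otimes> b)"
        using \<open>a \<in> _\<close> \<open>b \<in> _\<close> that by (simp add: m_assoc[symmetric])
      finally show ?thesis .
    qed
    then show ?thesis
      using that subgroup.m_closed[OF assms(1)] by auto
  qed
qed (use subgroup.subset[OF assms(1)] in auto)

lemma subgroup_centralizer:
  assumes "subgroup G GLC" "X \<subseteq> G"
  shows "subgroup (centralizer G X) GLC"
  using GLC.subgroup_centralizing[OF assms(1), of X] assms subgroup.subset[OF assms(1)]
  by (auto simp: centralizer_def)

text \<open>The coordinates \<open>\<xi> l\<close> are multiplicative with values in the commutative
  ring of complex numbers, so both products have the same coordinates; the coordinate map is
  injective on \<open>T\<close>.\<close>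

lemma torus_commute:
  assumes "torus T" "s \<in> T" "t \<in> T"
  shows "s ** t = t ** s"
proof -
  obtain k :: nat and \<xi> where \<xi>: "\<And>l. l < k \<Longrightarrow> \<xi> l \<in> characters T"
    and bij: "bij_betw (\<lambda>t. \<lambda>l\<in>{..<k}. \<xi> l t) T ({..<k} \<rightarrow>\<^sub>E - {0})"
    using assms(1) unfolding torus_def by blast
  have T: "subgroup T GLC"
    using assms(1) by (simp add: torus_def algebraic_group_def)
  have "s ** t \<in> T" "t ** s \<in> T"
    using subgroup.m_closed[OF T] assms by fastforce+
  moreover have "(\<lambda>l\<in>{..<k}. \<xi> l (s ** t)) = (\<lambda>l\<in>{..<k}. \<xi> l (t ** s))"
    using \<xi> assms(2,3) by (intro restrict_ext) (auto simp: characters_def)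
  ultimately show ?thesis
    using bij_betw_imp_inj_on[OF bij] by (auto dest: inj_onD)
qed

text \<open>Applied to \<open>T\<close> inside a Borel subgroup, this lets the set product
  \<open>(nT)B\<close> collapse to \<open>nB\<close>.\<close>

lemma (in group) subgroup_set_mult_supergroup:
  assumes "subgroup H G" "subgroup K G" "H \<subseteq> K"
  shows "H <#> K = K"
proof
  show "H <#> K \<subseteq> K"
    using assms(3) subgroup.m_closed[OF assms(2)] by (auto simp: set_mult_def)
  show "K \<subseteq> H <#> K"
    using subgroup.one_closed[OF assms(1)] subgroup.mem_carrier[OF assms(2)]
    by (force simp: set_mult_def)
qed

lemma (in group) normal_normalizer_within:
  assumes "subgroup K G" "subgroup H G" "H \<subseteq> K"
  shows "H \<lhd> G\<lparr>carrier := normalizer (G\<lparr>carrier := K\<rparr>) H\<rparr>"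
  using group.subgroup_in_normalizer[OF subgroup_imp_group[OF assms(1)] subgroup_incl[OF assms(2,1,3)]]
  by simp

text \<open>Inverses in \<open>K\<close> are those of the ambient group, so the conjugation
  condition no longer mentions \<open>K\<close>. Normalizers inside different groups can then be
  compared directly.\<close>

lemma (in group) mem_normalizer_within_iff:
  assumes "subgroup K G" "H \<subseteq> K"
  shows "g \<in> normalizer (G\<lparr>carrier := K\<rparr>) H \<longleftrightarrow> g \<in> K \<and> g <# H #> inv g = H"
  using assms by (auto simp: normalizer_def stabilizer_def)

section \<open>Elements of the Weyl group as cosets, and the fixed points \<open>w.B\<close>;
  \<open>K\<close> stands for either \<open>G\<close> or \<open>G'\<close>\<close>

context
  fixes K T :: "(complex^'n^'n) set"
  assumes K: "subgroup K GLC" and T: "subgroup T GLC" and TK: "T \<subseteq> K"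
begin

lemma group_weyl_group: "group (weyl_group K T)"
  unfolding weyl_group_def
  by (rule normal.factorgroup_is_group[OF GLC.normal_normalizer_within[OF K T TK]])

text \<open>Factor groups consist of right cosets, points of a flag variety are left cosets.
  Normality of \<open>T\<close> in its normalizer lets one representative serve for both.\<close>

lemma weyl_group_lcoset:
  assumes "w \<in> carrier (weyl_group K T)"
  obtains n where "n \<in> K" "w = n <#\<^bsub>GLC\<^esub> T" "w = T #>\<^bsub>GLC\<^esub> n"
proof -
  obtain n where n: "n \<in> normalizer (grp K) T" "w = T #>\<^bsub>GLC\<^esub> n"
    using assms by (auto simp: weyl_group_def carrier_FactGroup)
  moreover have "n \<in> K"
    using n(1) GLC.mem_normalizer_within_iff[OF K TK] by blast
  moreover have "T #>\<^bsub>GLC\<^esub> n = n <#\<^bsub>GLC\<^esub> T"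
    using normal.coset_eq[OF GLC.normal_normalizer_within[OF K T TK]] n(1) by simp
  ultimately show ?thesis
    using that[of n] by simp
qed

text \<open>With \<open>w = Tn\<close> this is \<open>T(Tn) = (TT)n = Tn\<close>.\<close>

lemma weyl_group_left_invariant:
  assumes "w \<in> carrier (weyl_group K T)"
  shows "T <#>\<^bsub>GLC\<^esub> w = w"
proof -
  obtain n where n: "n \<in> K" "w = T #>\<^bsub>GLC\<^esub> n"
    using weyl_group_lcoset[OF assms] .
  have "n \<in> carrier GLC"
    using n(1) subgroup.subset[OF K] by blast
  then show ?thesis
    using GLC.setmult_rcos_assoc[OF subgroup.subset[OF T] subgroup.subset[OF T]]
    by (simp only: n(2) GLC.subgroup_mult_id[OF T])
qed

lemma weyl_group_subset:
  assumes "w \<in> carrier (weyl_group K T)"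
  shows "w \<subseteq> K"
proof -
  obtain n where "n \<in> K" "w = n <#\<^bsub>GLC\<^esub> T"
    using weyl_group_lcoset[OF assms] .
  then show ?thesis
    using subgroup.m_closed[OF K, of n] TK by (auto simp: l_coset_def)
qed

context
  fixes B
  assumes B: "subgroup B GLC" and TB: "T \<subseteq> B"
begin

lemma weyl_point_lcoset:
  assumes "n \<in> K"
  shows "weyl_point B (n <#\<^bsub>GLC\<^esub> T) = n <#\<^bsub>GLC\<^esub> B"
  using GLC.setmult_lcos_assoc[OF subgroup.subset[OF T] subgroup.subset[OF B]]
    subgroup.mem_carrier[OF K assms]
  by (simp add: weyl_point_def GLC.subgroup_set_mult_supergroup[OF T B TB])

lemma weyl_point_in_flag_variety:
  assumes "w \<in> carrier (weyl_group K T)"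
  shows "weyl_point B w \<in> flag_variety K B"
proof -
  obtain n where "n \<in> K" "w = n <#\<^bsub>GLC\<^esub> T"
    using weyl_group_lcoset[OF assms] .
  then show ?thesis
    using weyl_point_lcoset[of n] by (auto simp: flag_variety_def LCOSETS_def)
qed

lemma weyl_point_in_fixed_points:
  assumes w: "w \<in> carrier (weyl_group K T)"
  shows "weyl_point B w \<in> fixed_points (flag_variety K B) T"
proof -
  have sub: "T \<subseteq> carrier GLC" "B \<subseteq> carrier GLC" "w \<subseteq> carrier GLC"
    using subgroup.subset[OF T] subgroup.subset[OF B] subgroup.subset[OF K] weyl_group_subset[OF w]
    by blast+
  have "t <#\<^bsub>GLC\<^esub> w = w" if "t \<in> T" for t
  proof -
    \<comment> \<open>Splitting off a factor \<open>T\<close> on the left of \<open>w\<close> gives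
      \<open>t\<close> something to be absorbed by, since \<open>tT = T\<close>.\<close>
    have "t <#\<^bsub>GLC\<^esub> w = t <#\<^bsub>GLC\<^esub> (T <#>\<^bsub>GLC\<^esub> w)"
      by (simp only: weyl_group_left_invariant[OF w])
    also have "\<dots> = (t <#\<^bsub>GLC\<^esub> T) <#>\<^bsub>GLC\<^esub> w"
      using GLC.setmult_lcos_assoc[OF sub(1,3)] sub(1) that by auto
    also have "t <#\<^bsub>GLC\<^esub> T = T"
      using GLC.coset_join3[OF _ T] sub(1) that by auto
    finally show ?thesis
      by (simp only: weyl_group_left_invariant[OF w])
  qed
  then have "t <#\<^bsub>GLC\<^esub> weyl_point B w = weyl_point B w" if "t \<in> T" for t
    using GLC.setmult_lcos_assoc[OF sub(3,2), of t] sub(1) that by (auto simp: weyl_point_def)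
  then show ?thesis
    using weyl_point_in_flag_variety[OF w] by (simp add: fixed_points_def)
qed

end

text \<open>The left side contains the factor-group product, which is a set product. Its inner
  \<open>T\<close> is absorbed by \<open>v\<close>, leaving \<open>n(vB)\<close>.\<close>

lemma weyl_point_mult:
  assumes "n \<in> K" "v \<in> carrier (weyl_group K T)" "B \<subseteq> carrier GLC"
  shows "weyl_point B ((n <#\<^bsub>GLC\<^esub> T) <#>\<^bsub>GLC\<^esub> v) = n <#\<^bsub>GLC\<^esub> weyl_point B v"
proof -
  have n: "n \<in> carrier GLC" and v: "v \<subseteq> carrier GLC"
    using subgroup.subset[OF K] assms(1) weyl_group_subset[OF assms(2)] by blast+
  show ?thesis
    using GLC.setmult_lcos_assoc[OF subgroup.subset[OF T] v n]
      GLC.setmult_lcos_assoc[OF v assms(3) n] weyl_group_left_invariant[OF assms(2)]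
    by (simp add: weyl_point_def)
qed

end


text \<open>An element of either group is literally a coset of \<open>T\<close> in the ambient
  group, so it suffices to compare the two normalizers.\<close>

lemma weyl_group_mono:
  assumes G: "subgroup G GLC" and G': "subgroup G' GLC" and "T \<subseteq> G'" "G' \<subseteq> G"
  shows "carrier (weyl_group G' T) \<subseteq> carrier (weyl_group G T)"
proof -
  have "T \<subseteq> G" using assms by blast
  then have "normalizer (grp G') T \<subseteq> normalizer (grp G) T"
    using GLC.mem_normalizer_within_iff[OF G, of T] GLC.mem_normalizer_within_iff[OF G', of T] assms
    by blast
  then show ?thesis
    by (auto simp: weyl_group_def carrier_FactGroup)
qed

section \<open>Pullback of a class along the section of the pattern map\<close>

theorem proposition3p2:
  fixes G B T G' B' \<sigma> :: "(complex^'n^'n) set"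
    and \<eta> :: "complex \<Rightarrow> complex^'n^'n"
    and \<iota> :: "(complex^'n^'n) set \<Rightarrow> (complex^'n^'n) set"
    and c :: "(complex^'n^'n) set \<Rightarrow> (((complex^'n^'n \<Rightarrow> complex) \<Rightarrow>\<^sub>0 nat) \<Rightarrow>\<^sub>0 rat) set"
    and \<phi> :: "(complex^'n^'n) set \<Rightarrow> (((complex^'n^'n \<Rightarrow> complex) \<Rightarrow>\<^sub>0 nat) \<Rightarrow>\<^sub>0 rat) set"
  assumes "algebraic_group G" and "connected_group G" and "simply_connected G" and "semisimple_group G"
    and "borel_subgroup G B" and "maximal_torus G T" and "T \<subseteq> B"
    and "cocharacter T \<eta>"
    and "G' = centralizer G (cochar_image \<eta>)" and "B' = G' \<inter> B"
    and "\<sigma> \<in> carrier (weyl_group G T)" and "min_length_in_coset G B T G' \<sigma>"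
    and "pattern_section G B T \<eta> G' B' \<sigma> \<iota>"
    and "c \<in> equiv_cohomology T (fixed_points (flag_variety G B) T)"
    and "\<phi> \<in> carrier (weyl_group G T) \<rightarrow>\<^sub>E carrier (sym_algebra T)"
    and "weyl_values G B T c = \<phi>"
  shows "pullback (fixed_points (flag_variety G' B') T) \<iota> c
           \<in> equiv_cohomology T (fixed_points (flag_variety G' B') T) \<and>
         weyl_values G' B' T (pullback (fixed_points (flag_variety G' B') T) \<iota> c)
           = (\<lambda>w \<in> carrier (weyl_group G' T). \<phi> (w \<otimes>\<^bsub>weyl_group G T\<^esub> \<sigma>))"
proof -
  have G: "subgroup G GLC" and B: "subgroup B GLC" and T: "subgroup T GLC"
    and BG: "B \<subseteq> G" and TG: "T \<subseteq> G"
    using assms(1,5,6)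
    by (auto simp: algebraic_group_def borel_subgroup_def maximal_torus_def torus_def)
  have img: "cochar_image \<eta> \<subseteq> T"
    using assms(8) by (auto simp: cocharacter_def cochar_image_def)
  have G': "subgroup G' GLC"
    using subgroup_centralizer[OF G] img TG assms(9) by blast
  have G'G: "G' \<subseteq> G"
    using assms(9) by (auto simp: centralizer_def)
  have TG': "T \<subseteq> G'"
    using torus_commute[of T] assms(6,9) img TG
    by (auto simp: centralizer_def maximal_torus_def)
  have B': "subgroup B' GLC"
    unfolding assms(10) using G' B by (rule GLC.subgroups_Inter_pair)
  have TB': "T \<subseteq> B'"
    using TG' assms(7,10) by blast
  note B_sub = subgroup.subset[OF B]

  \<comment> \<open>The unit of the Weyl group is the coset \<open>T\<close>, so the base point
    \<open>e.B'\<close> is the set product \<open>TB'\<close>, which equals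
    \<open>B'\<close>.\<close>
  have base: "\<iota> B' = weyl_point B \<sigma>"
    using assms(13) GLC.subgroup_set_mult_supergroup[OF T B' TB']
    by (simp add: pattern_section_def weyl_point_def weyl_group_def)
  have B'_flag: "B' \<in> flag_variety G' B'"
    using GLC.lcos_mult_one[OF subgroup.subset[OF B']] subgroup.one_closed[OF G']
    by (force simp: flag_variety_def LCOSETS_def)
  have equivariant: "\<iota> (g <#\<^bsub>GLC\<^esub> y) = g <#\<^bsub>GLC\<^esub> \<iota> y" if "g \<in> G'" "y \<in> flag_variety G' B'" for g y
    using assms(13) that by (simp add: pattern_section_def)

  let ?X' = "fixed_points (flag_variety G' B') T" and ?X = "fixed_points (flag_variety G B) T"
  \<comment> \<open>The class \<open>c\<close> has prescribed values in \<open>S\<close> only on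
    \<open>?X\<close>, so this is what puts the pullback into the cohomology of \<open>?X'\<close>.
    Writing \<open>y = gB'\<close> and \<open>\<sigma> = mT\<close>, the image is the coset of
    \<open>g ** m\<close>.\<close>
  have \<iota>_fixed: "\<iota> y \<in> ?X" if y: "y \<in> ?X'" for y
  proof -
    have y': "y \<in> flag_variety G' B'"
      using y by (simp add: fixed_points_def)
    then obtain g where g: "g \<in> G'" "y = g <#\<^bsub>GLC\<^esub> B'"
      by (auto simp: flag_variety_def LCOSETS_def)
    have "\<iota> y = g <#\<^bsub>GLC\<^esub> weyl_point B \<sigma>"
      using equivariant[OF g(1) B'_flag] g(2) base by simp
    moreover obtain m where m: "m \<in> G" "\<sigma> = m <#\<^bsub>GLC\<^esub> T"
      using weyl_group_lcoset[OF G T TG assms(11)] .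
    moreover have "weyl_point B (m <#\<^bsub>GLC\<^esub> T) = m <#\<^bsub>GLC\<^esub> B"
      using weyl_point_lcoset[OF G T TG B assms(7) m(1)] .
    moreover have "g <#\<^bsub>GLC\<^esub> (m <#\<^bsub>GLC\<^esub> B) = (g ** m) <#\<^bsub>GLC\<^esub> B"
      using GLC.lcos_m_assoc[OF B_sub, of g m] g(1) m(1) G'G subgroup.subset[OF G] by auto
    moreover have "g ** m \<in> G"
      using subgroup.m_closed[OF G, of g m] g(1) m(1) G'G by auto
    ultimately have "\<iota> y \<in> flag_variety G B"
      by (auto simp: flag_variety_def LCOSETS_def)
    \<comment> \<open>Equivariance applies to \<open>t\<close> because
      \<open>T \<subseteq> G'\<close>, and \<open>t\<close> fixes \<open>y\<close>.\<close>
    moreover have "t <#\<^bsub>GLC\<^esub> \<iota> y = \<iota> y" if "t \<in> T" for t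
      using equivariant[OF _ y', of t] TG' that y by (auto simp: fixed_points_def)
    ultimately show ?thesis
      by (simp add: fixed_points_def)
  qed

  have "c (\<iota> (weyl_point B' w)) = \<phi> (w \<otimes>\<^bsub>weyl_group G T\<^esub> \<sigma>)"
    if w: "w \<in> carrier (weyl_group G' T)" for w
  proof -
    obtain n where n: "n \<in> G'" "w = n <#\<^bsub>GLC\<^esub> T"
      using weyl_group_lcoset[OF G' T TG' w] .
    have "\<iota> (weyl_point B' w) = n <#\<^bsub>GLC\<^esub> weyl_point B \<sigma>"
      using equivariant[OF n(1) B'_flag] weyl_point_lcoset[OF G' T TG' B' TB' n(1)] n(2) base by simp
    also have "\<dots> = weyl_point B (w \<otimes>\<^bsub>weyl_group G T\<^esub> \<sigma>)"
      using weyl_point_mult[OF G T TG _ assms(11) B_sub, of n] n G'G by (auto simp: weyl_group_def)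
    finally have "\<iota> (weyl_point B' w) = weyl_point B (w \<otimes>\<^bsub>weyl_group G T\<^esub> \<sigma>)" .
    \<comment> \<open>\<open>weyl_values\<close> is \<open>undefined\<close> off the Weyl group of
      \<open>G\<close>, so membership must be known before \<open>\<phi>\<close> is evaluated at
      this product.\<close>
    moreover have "w \<otimes>\<^bsub>weyl_group G T\<^esub> \<sigma> \<in> carrier (weyl_group G T)"
      using weyl_group_mono[OF G G' TG' G'G] w assms(11) group_weyl_group[OF G T TG]
      by (meson group.is_monoid monoid.m_closed subsetD)
    ultimately show ?thesis
      using assms(16) by (auto simp: weyl_values_def)
  qed
  \<comment> \<open>The pullback is restricted to \<open>?X'\<close>; only there is its value given
    by \<open>c\<close> after \<open>\<iota>\<close>.\<close>
  moreover have "weyl_point B' w \<in> ?X'" if "w \<in> carrier (weyl_group G' T)" for w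
    using weyl_point_in_fixed_points[OF G' T TG' B' TB' that] .
  ultimately have "weyl_values G' B' T (pullback ?X' \<iota> c)
      = (\<lambda>w \<in> carrier (weyl_group G' T). \<phi> (w \<otimes>\<^bsub>weyl_group G T\<^esub> \<sigma>))"
    by (auto simp: weyl_values_def pullback_def intro!: restrict_ext)
  moreover have "pullback ?X' \<iota> c \<in> equiv_cohomology T ?X'"
    using assms(14) \<iota>_fixed by (auto simp: pullback_def equiv_cohomology_def)
  ultimately show ?thesis
    by blast
qed

end
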